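(* Let $n\ge 1$ and let $G$ be a connected graph on $n$ vertices. Let $K_n$ be the complete graph on $n$ vertices. Then $G\geq_s K_n$ if and only if $X_G$ is Schur-positive.
   Context: All graphs are finite and simple. The chromatic symmetric function of a graph $G$ with vertices $v_1,\dots,v_n$ is $X_G=\sum_{\kappa}x_{\kappa(v_1)}\cdots x_{\kappa(v_n)}$, summed over all proper colorings $\kappa:V(G)\to\{1,2,3,\dots\}$ (adjacent vertices get different colors); it is a homogeneous symmetric function of degree $n$ in commuting variables $x_1,x_2,\dots$ over $\mathbb{Q}$. Let $s_\lambda$ denote the Schur symmetric function of the partition $\lambda$ (so $s_{(1^n)}=e_n$, the $n$-th elementary symmetric function); $\{s_\lambda:\lambda\vdash n\}$ is a basis of the degree-$n$ symmetric functions. $[s_\lambda]F$ denotes the coefficient of $s_\lambda$ in $F$, and $F$ is Schur-positive if $[s_\lambda]F\ge 0$ for all $\lambda$. For connected graphs $G,H$ on $n$ vertices (for which $[s_{(1^n)}]X_G$ and $[s_{(1^n)}]X_H$ are positive), set $$X_s(G,H)=X_G-\frac{[s_{(1^n)}]X_G}{[s_{(1^n)}]X_H}X_H,$$ and write $G\geq_s H$ if $X_s(G,H)$ is Schur-positive. *)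

theory Defs
  imports
    "HOL.Rat"
    "HOL-Library.FuncSet"
    "HOL-Library.Multiset"
    "HOL-Library.Function_Algebras"
    "Graph_Theory.Kuratowski"
begin

text \<open>
  A monomial in the commuting variables \<open>x\<^sub>1, x\<^sub>2, \<dots>\<close> is encoded as the finite multiset of its
  indices, e.g. \<open>{#1, 1, 3#}\<close> stands for \<open>x\<^sub>1 x\<^sub>1 x\<^sub>3\<close>. A formal power series over the rationals
  (of which symmetric functions are special cases) is its coefficient function. The multiset
  type also allows the index 0; such monomials have coefficient 0 in every series below.
\<close>

type_synonym series = "nat multiset \<Rightarrow> rat"

definition scale_series :: "rat \<Rightarrow> series \<Rightarrow> series" where
  "scale_series c F = (\<lambda>M. c * F M)"

interpretation series: vector_space scale_series
  by unfold_locales (auto simp: scale_series_def fun_eq_iff algebra_simps)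


text \<open>
  Finite simple graphs are the locale \<^locale>\<open>graph\<close>: finite, loopless, symmetric digraphs without
  parallel arcs, each undirected edge being a pair of opposite arcs.
\<close>

definition proper_colorings :: "('a, 'b) pre_digraph \<Rightarrow> ('a \<Rightarrow> nat) set" where
  "proper_colorings G =
    {\<kappa> \<in> verts G \<rightarrow>\<^sub>E {1..}. \<forall>u v. u \<rightarrow>\<^bsub>G\<^esub> v \<longrightarrow> \<kappa> u \<noteq> \<kappa> v}"

text \<open>The coefficient of a monomial counts the (finitely many) proper colorings contributing it.\<close>

definition chromatic_sym :: "('a, 'b) pre_digraph \<Rightarrow> series" where
  "chromatic_sym G =
    (\<lambda>M. of_nat (card {\<kappa> \<in> proper_colorings G. image_mset \<kappa> (mset_set (verts G)) = M}))"


definition is_partition :: "nat list \<Rightarrow> bool" where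
  "is_partition \<mu> \<longleftrightarrow> sorted_wrt (\<ge>) \<mu> \<and> 0 \<notin> set \<mu>"

definition cells :: "nat list \<Rightarrow> (nat \<times> nat) set" where
  "cells \<mu> = {(i, j). i < length \<mu> \<and> j < \<mu> ! i}"

text \<open>Semistandard Young tableaux: rows weakly increasing, columns strictly increasing.\<close>

definition ssyt :: "nat list \<Rightarrow> (nat \<times> nat \<Rightarrow> nat) set" where
  "ssyt \<mu> = {T \<in> cells \<mu> \<rightarrow>\<^sub>E {1..}.
     (\<forall>i j j'. (i, j) \<in> cells \<mu> \<and> (i, j') \<in> cells \<mu> \<and> j < j' \<longrightarrow> T (i, j) \<le> T (i, j')) \<and>
     (\<forall>i i' j. (i, j) \<in> cells \<mu> \<and> (i', j) \<in> cells \<mu> \<and> i < i' \<longrightarrow> T (i, j) < T (i', j))}"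

definition schur :: "nat list \<Rightarrow> series" where
  "schur \<mu> = (\<lambda>M. of_nat (card {T \<in> ssyt \<mu>. image_mset T (mset_set (cells \<mu>)) = M}))"

definition schur_basis :: "series set" where
  "schur_basis = schur ` {\<mu>. is_partition \<mu>}"

text \<open>
  \<open>[s\<^sub>\<mu>] F\<close>. The library's \<open>representation\<close> gives the coefficients of a vector with respect to a
  linearly independent set; the value is meaningful for \<open>F\<close> in the span of the Schur functions,
  that is, for symmetric functions.
\<close>

definition schur_coeff :: "nat list \<Rightarrow> series \<Rightarrow> rat" where
  "schur_coeff \<mu> F = series.representation schur_basis F (schur \<mu>)"

text \<open>
  The first conjunct says that \<open>F\<close> is a symmetric function. It prevents the default value 0 of
  \<open>representation\<close> from making other series Schur-positive.
\<close>

definition schur_positive :: "series \<Rightarrow> bool" where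
  "schur_positive F \<longleftrightarrow>
    F \<in> series.span schur_basis \<and> (\<forall>\<mu>. is_partition \<mu> \<longrightarrow> 0 \<le> schur_coeff \<mu> F)"


text \<open>
  The next two notions are meant for connected graphs with equally many vertices \<open>n\<close>; the partition
  \<open>(1\<^sup>n)\<close> is \<open>replicate n 1\<close>.
\<close>

definition X_s :: "('a, 'b) pre_digraph \<Rightarrow> ('c, 'd) pre_digraph \<Rightarrow> series" where
  "X_s G H = chromatic_sym G -
     scale_series (schur_coeff (replicate (card (verts G)) 1) (chromatic_sym G) /
                   schur_coeff (replicate (card (verts H)) 1) (chromatic_sym H))
       (chromatic_sym H)"

definition schur_ge :: "('a, 'b) pre_digraph \<Rightarrow> ('c, 'd) pre_digraph \<Rightarrow> bool"
    (infix \<open>\<ge>\<^sub>s\<close> 50) where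
  "G \<ge>\<^sub>s H \<longleftrightarrow> schur_positive (X_s G H)"

end

theory Submission
  imports Defs
begin

text \<open>
  For a symmetric function \<open>F\<close> of degree \<open>n\<close>, \<open>[s\<^bsub>(1\<^sup>n)\<^esub>] F\<close> is the sum of
  \<open>(-1)\<^bsup>n - l\<^esup> [x\<^sub>1\<^bsup>a\<^sub>1\<^esup> \<dots> x\<^sub>l\<^bsup>a\<^sub>l\<^esup>] F\<close> over the compositions \<open>(a\<^sub>1, \<dots>, a\<^sub>l)\<close> of \<open>n\<close>. If \<open>F\<close> is the
  generating function of a family of maps on an \<open>n\<close>-element set, this is a signed count of the
  packed maps in the family, those whose image is an initial segment \<open>{1..l}\<close>. Splitting off the
  block of maximal value gives a recursion, by which the count is \<open>1\<close> or \<open>0\<close> for semistandard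
  tableaux according to whether the shape is a single column, and \<open>1\<close> for the maps that increase
  strictly along a fixed acyclic orientation. Every proper coloring induces such an orientation, so
  \<open>[s\<^bsub>(1\<^sup>n)\<^esub>] X\<^sub>G\<close> counts acyclic orientations and is nonnegative. Since \<open>X\<close> of the complete graph
  is \<open>n! s\<^bsub>(1\<^sup>n)\<^esub>\<close>, the only effect of subtracting its multiple from \<open>X\<^sub>G\<close> is to
  replace this nonnegative coefficient by \<open>0\<close>.
\<close>

section \<open>Packed maps and the recursion on the block of maximal value\<close>

definition packed_maps :: "'a set \<Rightarrow> ('a \<Rightarrow> nat) set" where
  "packed_maps V = {f \<in> extensional V. f ` V = {1..card (f ` V)}}"

text \<open>The exponent is a sum because it has the parity of n - l and avoids subtraction on
  \<open>nat\<close>.\<close>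

definition signed_count :: "'a set \<Rightarrow> ('a \<Rightarrow> nat) set \<Rightarrow> rat" where
  "signed_count V F = (\<Sum>f \<in> F \<inter> packed_maps V. (-1) ^ (card V + card (f ` V)))"

text \<open>Strict constraints \<open>P\<close> and weak constraints \<open>Q\<close>, as for (P,
  \<omega>)-partitions: tableaux have both kinds, colorings compatible with an orientation only
  strict ones. \<open>V\<close> is a separate argument so that the recursion can shrink it under
  fixed relations.\<close>

definition order_maps :: "('a \<times> 'a) set \<Rightarrow> ('a \<times> 'a) set \<Rightarrow> 'a set \<Rightarrow> ('a \<Rightarrow> nat) set" where
  "order_maps P Q V = {f \<in> V \<rightarrow>\<^sub>E {1..}.
     \<forall>u\<in>V. \<forall>v\<in>V. ((u, v) \<in> P \<longrightarrow> f u < f v) \<and> ((u, v) \<in> Q \<longrightarrow> f u \<le> f v)}"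

text \<open>Candidates for the set where a map attains its maximum: nothing exceeds the maximum, and
  whatever is weakly above a maximal point is maximal too.\<close>

definition top_blocks :: "('a \<times> 'a) set \<Rightarrow> ('a \<times> 'a) set \<Rightarrow> 'a set \<Rightarrow> 'a set set" where
  "top_blocks P Q V = {S. S \<subseteq> V \<and> S \<noteq> {} \<and>
     (\<forall>u\<in>S. \<forall>v\<in>V. (u, v) \<notin> P \<and> ((u, v) \<in> Q \<longrightarrow> v \<in> S))}"

lemma packed_mapsD:
  assumes "f \<in> packed_maps V"
  shows "f \<in> extensional V" "f ` V = {1..card (f ` V)}"
  using assms unfolding packed_maps_def by blast+

lemma packed_maps_le:
  assumes "f \<in> packed_maps V" "v \<in> V"
  shows "1 \<le> f v" "f v \<le> card (f ` V)"
  using packed_mapsD(2)[OF assms(1)] assms(2) by (metis atLeastAtMost_iff imageI)+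

lemma finite_packed_maps:
  assumes "finite V"
  shows "finite (packed_maps V)"
proof (rule finite_subset)
  show "packed_maps V \<subseteq> V \<rightarrow>\<^sub>E {1..card V}"
  proof
    fix f assume f: "f \<in> packed_maps V"
    have "card (f ` V) \<le> card V" by (rule card_image_le[OF assms])
    then show "f \<in> V \<rightarrow>\<^sub>E {1..card V}"
      using packed_maps_le[OF f] packed_mapsD(1)[OF f] by (auto simp: PiE_def) (meson le_trans)
  qed
  show "finite (V \<rightarrow>\<^sub>E {1..card V})" by (intro finite_PiE assms) auto
qed

lemma finite_top_blocks: "finite V \<Longrightarrow> finite (top_blocks P Q V)"
  by (rule finite_subset[of _ "Pow V"]) (auto simp: top_blocks_def)

lemma image_below_top_block:
  assumes f: "f \<in> packed_maps V"
  shows "f ` (V - {v \<in> V. f v = card (f ` V)}) = {1..card (f ` V) - 1}"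
proof -
  have "f ` (V - {v \<in> V. f v = card (f ` V)}) = f ` V - {card (f ` V)}" by auto
  also have "\<dots> = {1..card (f ` V)} - {card (f ` V)}" using packed_mapsD(2)[OF f] by argo
  also have "\<dots> = {1..card (f ` V) - 1}" by auto
  finally show ?thesis .
qed

lemma image_insert_top_block:
  assumes g: "g ` (V - S) = {1..k}" and S: "S \<subseteq> V" "S \<noteq> {}"
  shows "(\<lambda>v. if v \<in> S then Suc k else g v) ` V = {1..Suc k}"
proof -
  have "(\<lambda>v. if v \<in> S then Suc k else g v) ` V = insert (Suc k) (g ` (V - S))"
    using S by (auto simp: image_iff)
  then show ?thesis using g by auto
qed

text \<open>A packed map amounts to its fiber \<open>S\<close> over the maximum and a packed map on
  \<open>V - S\<close>; the constraints that involve \<open>S\<close> say just that \<open>S\<close>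
  is a top block. Removing \<open>S\<close> loses \<open>card S\<close> points and one value, hence
  the sign.\<close>

lemma signed_count_order_maps:
  assumes fin: "finite V" and ne: "V \<noteq> {}"
  shows "signed_count V (order_maps P Q V) =
    (\<Sum>S\<in>top_blocks P Q V. (-1) ^ (card S + 1) * signed_count (V - S) (order_maps P Q (V - S)))"
proof -
  define \<F> where "\<F> W = order_maps P Q W \<inter> packed_maps W" for W
  define top where "top f = {v \<in> V. f v = card (f ` V)}" for f :: "'a \<Rightarrow> nat"
  \<comment> \<open>Inverse to cutting off \<open>top f\<close>: the values of \<open>g\<close> fill
    an initial segment, and \<open>S\<close> gets the next one.\<close>
  define ext where "ext = (\<lambda>(S, g) v. if v \<in> S then Suc (card (g ` (V - S))) else (g v :: nat))"
  have fin\<F>: "finite (\<F> W)" if "W \<subseteq> V" for W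
    using finite_packed_maps finite_subset[OF that fin] by (auto simp: \<F>_def)
  have "(\<Sum>S\<in>top_blocks P Q V. (-1) ^ (card S + 1) * signed_count (V - S) (order_maps P Q (V - S))) =
    (\<Sum>S\<in>top_blocks P Q V. \<Sum>g\<in>\<F> (V - S).
       (-1) ^ (card S + 1) * (-1) ^ (card (V - S) + card (g ` (V - S))))"
    by (simp add: signed_count_def \<F>_def sum_distrib_left)
  also have "\<dots> = (\<Sum>(S, g)\<in>(SIGMA S:top_blocks P Q V. \<F> (V - S)).
       (-1) ^ (card S + 1) * (-1) ^ (card (V - S) + card (g ` (V - S))))"
    using finite_top_blocks[OF fin] fin\<F> by (subst sum.Sigma) auto
  also have "\<dots> = (\<Sum>f\<in>\<F> V. (-1) ^ (card V + card (f ` V)))"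
  proof (rule sum.reindex_bij_witness[where i = "\<lambda>f. (top f, restrict f (V - top f))" and j = ext])
    fix a assume "a \<in> (SIGMA S:top_blocks P Q V. \<F> (V - S))"
    then obtain S g where a: "a = (S, g)" and S: "S \<in> top_blocks P Q V" and g: "g \<in> \<F> (V - S)"
      by auto
    define k where "k = card (g ` (V - S))"
    have SV: "S \<subseteq> V" "S \<noteq> {}" using S by (auto simp: top_blocks_def)
    have gk: "g ` (V - S) = {1..k}" and ge: "g \<in> extensional (V - S)"
      using g packed_mapsD[of g "V - S"] unfolding \<F>_def k_def by blast+
    have gle: "1 \<le> g v" "g v \<le> k" if "v \<in> V - S" for v
      using imageI[OF that, of g] unfolding gk by auto
    have e: "ext a = (\<lambda>v. if v \<in> S then Suc k else g v)" unfolding ext_def a k_def by simp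
    have im: "ext a ` V = {1..Suc k}" unfolding e by (rule image_insert_top_block[OF gk SV])
    have top: "top (ext a) = S"
      unfolding top_def im using SV gle by (force simp: e)
    show "(top (ext a), restrict (ext a) (V - top (ext a))) = a"
      unfolding top unfolding e using ge by (auto simp: a fun_eq_iff restrict_def extensional_def)
    have "ext a \<in> V \<rightarrow>\<^sub>E {1..}"
      using SV ge gle by (auto simp: e PiE_def extensional_def)
    moreover have "((u, v) \<in> P \<longrightarrow> ext a u < ext a v) \<and> ((u, v) \<in> Q \<longrightarrow> ext a u \<le> ext a v)"
      if uv: "u \<in> V" "v \<in> V" for u v
    proof (cases "u \<in> S")
      case True
      then have "(u, v) \<notin> P" "(u, v) \<in> Q \<longrightarrow> v \<in> S" using S uv by (auto simp: top_blocks_def)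
      then show ?thesis using True by (simp add: e)
    next
      case False
      \<comment> \<open>A point outside \<open>S\<close> has value at most \<open>k\<close>, so its
        constraints into \<open>S\<close> hold automatically.\<close>
      then have "g u \<le> k" using gle uv by simp
      moreover have "((u, v) \<in> P \<longrightarrow> g u < g v) \<and> ((u, v) \<in> Q \<longrightarrow> g u \<le> g v)" if "v \<notin> S"
        using g uv that False by (simp add: \<F>_def order_maps_def)
      ultimately show ?thesis using False by (auto simp: e)
    qed
    ultimately show "ext a \<in> \<F> V"
      using im by (auto simp: \<F>_def order_maps_def packed_maps_def PiE_def)
    have "card V = card S + card (V - S)"
      using SV(1) fin by (metis card_Diff_subset card_mono finite_subset le_add_diff_inverse)
    then show "((-1) :: rat) ^ (card V + card (ext a ` V)) =
        (case a of (S, g) \<Rightarrow> (-1) ^ (card S + 1) * (-1) ^ (card (V - S) + card (g ` (V - S))))"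
      unfolding im by (simp add: a k_def power_add)
  next
    fix f assume f: "f \<in> \<F> V"
    then have fp: "f \<in> packed_maps V" by (simp add: \<F>_def)
    note fle = packed_maps_le[OF fp] and im = packed_mapsD(2)[OF fp]
    \<comment> \<open>With at least one value, the successor of l - 1 is l again when the block is
      put back.\<close>
    have pos: "card (f ` V) > 0" using fin ne by (simp add: card_gt_0_iff)
    have below: "f ` (V - top f) = {1..card (f ` V) - 1}"
      unfolding top_def by (rule image_below_top_block[OF fp])
    have rim: "restrict f (V - top f) ` (V - top f) = {1..card (f ` V) - 1}"
      using below by simp
    have "card (f ` V) \<in> f ` V" by (subst im) (use pos in auto)
    then have topne: "top f \<noteq> {}" by (auto simp: top_def)
    show "ext (top f, restrict f (V - top f)) = f"
      using pos packed_mapsD(1)[OF fp] unfolding ext_def split rim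
      by (auto simp: fun_eq_iff top_def extensional_def)
    have "top f \<in> top_blocks P Q V"
      unfolding top_blocks_def
    proof (intro CollectI conjI ballI impI topne)
      show "top f \<subseteq> V" by (auto simp: top_def)
      fix u v assume u: "u \<in> top f" and v: "v \<in> V"
      have uV: "u \<in> V" and fu: "f u = card (f ` V)" using u by (auto simp: top_def)
      have rel: "((u, v) \<in> P \<longrightarrow> f u < f v) \<and> ((u, v) \<in> Q \<longrightarrow> f u \<le> f v)"
        using f uV v by (simp add: \<F>_def order_maps_def)
      show "(u, v) \<notin> P" using rel fu fle(2)[OF v] by linarith
      show "v \<in> top f" if "(u, v) \<in> Q" using rel that fu fle(2)[OF v] v by (simp add: top_def)
    qed
    moreover have "restrict f (V - top f) \<in> packed_maps (V - top f)"
      by (simp add: packed_maps_def below)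
    moreover have "restrict f (V - top f) \<in> order_maps P Q (V - top f)"
      using f by (auto simp: \<F>_def order_maps_def PiE_def Pi_def)
    ultimately show "(top f, restrict f (V - top f)) \<in> (SIGMA S:top_blocks P Q V. \<F> (V - S))"
      by (simp add: \<F>_def)
  qed
  finally show ?thesis by (simp add: signed_count_def \<F>_def)
qed

lemma signed_count_empty: "signed_count {} (order_maps P Q {}) = 1"
proof -
  have "order_maps P Q {} \<inter> packed_maps {} = {\<lambda>x. undefined}"
    by (auto simp: order_maps_def packed_maps_def)
  then show ?thesis by (simp add: signed_count_def)
qed

section \<open>Cancellation by toggling an element\<close>

text \<open>Toggling \<open>b\<close> is an involution of the family that changes the parity of the
  size, so the sum equals its own negative.\<close>

lemma sum_sign_toggle:
  fixes \<A> :: "'a set set"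
  assumes fin: "finite \<A>" "\<And>S. S \<in> \<A> \<Longrightarrow> finite S"
    and ins: "\<And>S. S \<in> \<A> \<Longrightarrow> insert b S \<in> \<A>"
    and del: "\<And>S. S \<in> \<A> \<Longrightarrow> S - {b} \<in> \<A>"
  shows "(\<Sum>S\<in>\<A>. (-1) ^ card S :: rat) = 0"
proof -
  define t where "t S = (if b \<in> S then S - {b} else insert b S)" for S
  have sgn: "(-1) ^ card (t S) = (- ((-1) ^ card S) :: rat)" if "S \<in> \<A>" for S
  proof (cases "b \<in> S")
    case True
    have "card S = Suc (card (S - {b}))"
      by (rule card_Suc_Diff1[OF fin(2)[OF that] True, symmetric])
    then have "(-1) ^ card S = (- ((-1) ^ card (S - {b})) :: rat)"
      by (simp only: power_Suc mult_minus1)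
    then show ?thesis unfolding t_def if_P[OF True] by (simp only: minus_minus)
  qed (use fin(2)[OF that] in \<open>simp add: t_def\<close>)
  have tt: "t (t S) = S" for S by (auto simp: t_def)
  have tA: "t S \<in> \<A>" if "S \<in> \<A>" for S using ins[OF that] del[OF that] by (simp add: t_def)
  have "(\<Sum>S\<in>\<A>. (-1) ^ card S :: rat) = (\<Sum>S\<in>\<A>. - ((-1) ^ card S))"
    by (rule sum.reindex_bij_witness[where i = t and j = t])
       (simp_all add: tt tA sgn)
  then show ?thesis by (simp add: sum_negf)
qed

lemma sum_sign_nonempty_subsets:
  assumes "finite A" "A \<noteq> {}"
  shows "(\<Sum>S | S \<subseteq> A \<and> S \<noteq> {}. (-1) ^ (card S + 1) :: rat) = 1"
proof -
  obtain b where b: "b \<in> A" using assms(2) by auto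
  have "(\<Sum>S\<in>Pow A. (-1) ^ card S :: rat) = 0"
    by (rule sum_sign_toggle[where b = b]) (use assms b finite_subset in auto)
  moreover have "Pow A = insert {} {S. S \<subseteq> A \<and> S \<noteq> {}}" by auto
  moreover have "finite {S. S \<subseteq> A \<and> S \<noteq> {}}" using assms by simp
  ultimately show ?thesis by (simp add: sum_negf)
qed

section \<open>Acyclic orientations and proper colorings\<close>

text \<open>Without weak constraints the top blocks are the nonempty sets of sinks of
  \<open>P\<close>, so by induction the recursion is an alternating sum over nonempty subsets. The
  map \<open>f\<close> certifies that \<open>P\<close> is acyclic on \<open>V\<close>: a point where
  it is maximal is a sink.\<close>

lemma signed_count_strict:
  assumes "finite V" and "f \<in> order_maps P {} V"
  shows "signed_count V (order_maps P {} V) = 1"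
  using assms
proof (induction "card V" arbitrary: V f rule: less_induct)
  case less
  show ?case
  proof (cases "V = {}")
    case False
    define A where "A = {u \<in> V. \<forall>v\<in>V. (u, v) \<notin> P}"
    have tb: "top_blocks P {} V = {S. S \<subseteq> A \<and> S \<noteq> {}}"
      by (auto simp: top_blocks_def A_def)
    have finA: "finite A" using less.prems(1) by (simp add: A_def)
    have "Max (f ` V) \<in> f ` V" using less.prems(1) False by simp
    then obtain u where u: "u \<in> V" "f u = Max (f ` V)" by auto
    have "f v \<le> f u" if "v \<in> V" for v unfolding u(2) using less.prems(1) that by simp
    then have "u \<in> A" using less.prems(2) u(1) by (fastforce simp: A_def order_maps_def dest: leD)
    then have ne: "A \<noteq> {}" by auto
    have IH: "signed_count (V - S) (order_maps P {} (V - S)) = 1" if "S \<subseteq> A" "S \<noteq> {}" for S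
    proof (rule less.hyps)
      show "card (V - S) < card V"
        using that less.prems(1) by (intro psubset_card_mono) (auto simp: A_def)
      show "restrict f (V - S) \<in> order_maps P {} (V - S)"
        using less.prems(2) by (auto simp: order_maps_def PiE_def Pi_def)
    qed (use less.prems in auto)
    show ?thesis
      unfolding signed_count_order_maps[OF less.prems(1) False] tb
      using IH sum_sign_nonempty_subsets[OF finA ne] by simp
  qed (simp add: signed_count_empty)
qed

text \<open>Since \<open>E\<close> is symmetric and \<open>f\<close> is proper, exactly one of two
  opposite arcs is increasing under \<open>f\<close>; strictness along these arcs settles the
  comparison on all of \<open>E\<close>. So the colorings with one orientation form a family covered
  by \<open>signed_count_strict\<close>.\<close>

lemma order_maps_eqI:
  fixes f :: "'a \<Rightarrow> nat"
  assumes E: "E \<subseteq> V \<times> V" "sym E"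
    and f: "f \<in> V \<rightarrow>\<^sub>E {1..}" "\<forall>(u, v)\<in>E. f u \<noteq> f v"
  shows "{g \<in> V \<rightarrow>\<^sub>E {1..}. (\<forall>(u, v)\<in>E. g u \<noteq> g v) \<and>
           {(u, v) \<in> E. g u < g v} = {(u, v) \<in> E. f u < f v}} =
         order_maps {(u, v) \<in> E. f u < f v} {} V"
    (is "?L = ?R")
proof
  show "?L \<subseteq> ?R" by (fastforce simp: order_maps_def)
  show "?R \<subseteq> ?L"
  proof
    fix g assume g: "g \<in> ?R"
    have lt: "g u < g v" if "(u, v) \<in> E" "f u < f v" for u v
      using g that E(1) by (auto simp: order_maps_def)
    have iff: "g u < g v \<longleftrightarrow> f u < f v" if "(u, v) \<in> E" for u v
    proof (rule iffI)
      assume gl: "g u < g v"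
      show "f u < f v"
      proof (rule ccontr)
        assume "\<not> f u < f v"
        then have "f v < f u" using f(2) that by fastforce
        then have "g v < g u" using lt that E(2) by (auto dest: symD)
        then show False using gl by simp
      qed
    qed (rule lt[OF that])
    have "g u \<noteq> g v" if "(u, v) \<in> E" for u v
      using f(2) that iff[OF that] iff[of v u] symD[OF E(2) that] by fastforce
    then show "g \<in> ?L" using g iff by (auto simp: order_maps_def)
  qed
qed

text \<open>Group the packed colorings by induced orientation: each nonempty class contributes 1,
  each empty one 0.\<close>

lemma signed_count_proper_nonneg:
  assumes fin: "finite V" and E: "E \<subseteq> V \<times> V" "sym E"
  shows "signed_count V {f \<in> V \<rightarrow>\<^sub>E {1..}. \<forall>(u, v)\<in>E. f u \<noteq> f v} \<ge> 0"
proof -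
  let ?F = "{f \<in> V \<rightarrow>\<^sub>E {1..}. \<forall>(u, v)\<in>E. f u \<noteq> (f v :: nat)}"
  let ?w = "\<lambda>f. (-1 :: rat) ^ (card V + card (f ` V))"
  define ori where "ori f = {(u, v) \<in> E. f u < f v}" for f :: "'a \<Rightarrow> nat"
  have finF: "finite (?F \<inter> packed_maps V)" using finite_packed_maps[OF fin] by simp
  have "finite E" using E(1) fin by (meson finite_SigmaI finite_subset)
  then have "signed_count V ?F = (\<Sum>D\<in>Pow E. \<Sum>f\<in>{f \<in> ?F \<inter> packed_maps V. ori f = D}. ?w f)"
    unfolding signed_count_def using finF by (intro sum.group[symmetric]) (auto simp: ori_def)
  also have "\<dots> \<ge> 0"
  proof (rule sum_nonneg)
    fix D
    show "(\<Sum>f\<in>{f \<in> ?F \<inter> packed_maps V. ori f = D}. ?w f) \<ge> 0"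
    proof (cases "{f \<in> ?F \<inter> packed_maps V. ori f = D} = {}")
      case False
      then obtain f where f: "f \<in> ?F" "ori f = D" by auto
      have D: "{g \<in> ?F. ori g = D} = order_maps D {} V"
        using order_maps_eqI[OF E, of f] f unfolding ori_def by auto
      have "{g \<in> ?F \<inter> packed_maps V. ori g = D} = order_maps D {} V \<inter> packed_maps V"
        unfolding D[symmetric] by blast
      then have "(\<Sum>f\<in>{f \<in> ?F \<inter> packed_maps V. ori f = D}. ?w f) = signed_count V (order_maps D {} V)"
        by (simp only: signed_count_def)
      also have "\<dots> = 1" using f D by (intro signed_count_strict[OF fin, of f]) auto
      finally show ?thesis by simp
    next
      case True
      show ?thesis unfolding True by simp
    qed
  qed
  finally show ?thesis .
qed

section \<open>Semistandard fillings of diagrams\<close>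

definition col_order :: "((nat \<times> nat) \<times> (nat \<times> nat)) set" where
  "col_order = {((i, j), (i', j')). i < i' \<and> j = j'}"

definition row_order :: "((nat \<times> nat) \<times> (nat \<times> nat)) set" where
  "row_order = {((i, j), (i', j')). i = i' \<and> j < j'}"

text \<open>Young diagrams as plain cell sets, from which top blocks can be removed
  directly.\<close>

definition down_closed :: "(nat \<times> nat) set \<Rightarrow> bool" where
  "down_closed V \<longleftrightarrow> (\<forall>i j i' j'. (i, j) \<in> V \<and> i' \<le> i \<and> j' \<le> j \<longrightarrow> (i', j') \<in> V)"

lemma top_blockD:
  assumes "S \<in> top_blocks P Q V"
  shows "S \<subseteq> V" "S \<noteq> {}"
    and "u \<in> S \<Longrightarrow> v \<in> V \<Longrightarrow> (u, v) \<notin> P"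
    and "u \<in> S \<Longrightarrow> v \<in> V \<Longrightarrow> (u, v) \<in> Q \<Longrightarrow> v \<in> S"
  using assms unfolding top_blocks_def by blast+

lemma top_blockI:
  assumes "S \<subseteq> V" "S \<noteq> {}"
    and "\<And>u v. u \<in> S \<Longrightarrow> v \<in> V \<Longrightarrow> (u, v) \<notin> P"
    and "\<And>u v. u \<in> S \<Longrightarrow> v \<in> V \<Longrightarrow> (u, v) \<in> Q \<Longrightarrow> v \<in> S"
  shows "S \<in> top_blocks P Q V"
  using assms unfolding top_blocks_def by blast

text \<open>Go from a surviving cell through the corner \<open>(i', j)\<close>: it survives because
  a top block has no cell of \<open>V\<close> below any of its cells, and then
  \<open>(i', j')\<close> survives because a top block extends to the right along rows.\<close>

lemma down_closed_diff_top_block: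
  assumes V: "down_closed V" and S: "S \<in> top_blocks col_order row_order V"
  shows "down_closed (V - S)"
  unfolding down_closed_def
proof (intro allI impI)
  fix i j i' j' assume a: "(i, j) \<in> V - S \<and> i' \<le> i \<and> j' \<le> j"
  have in1: "(i', j') \<in> V" and in2: "(i', j) \<in> V"
    using a V unfolding down_closed_def by blast+
  have "(i', j) \<notin> S"
  proof
    assume s: "(i', j) \<in> S"
    have "((i', j), (i, j)) \<notin> col_order" using top_blockD(3)[OF S s] a by blast
    then have "i' = i" using a by (simp add: col_order_def)
    then show False using s a by simp
  qed
  then have "(i', j') \<notin> S"
    using top_blockD(4)[OF S _ in2, of "(i', j')"] a
    by (cases "j' = j") (auto simp: row_order_def)
  then show "(i', j') \<in> V - S" using in1 by simp
qed

text \<open>By induction only top blocks whose removal leaves cells of the first column count. If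
  \<open>V\<close> is one column, its bottom cell is the only top block; otherwise toggling the
  bottom cell \<open>(m, 0)\<close> of the first column cancels everything.\<close>

lemma signed_count_tableaux:
  assumes "finite V" "down_closed V"
  shows "signed_count V (order_maps col_order row_order V) = (if V \<subseteq> UNIV \<times> {0} then 1 else 0)"
  using assms
proof (induction "card V" arbitrary: V rule: less_induct)
  case less
  let ?Z = "UNIV \<times> {0 :: nat} :: (nat \<times> nat) set"
  let ?T = "top_blocks col_order row_order V"
  note fin = less.prems(1) and down = less.prems(2)
  show ?case
  proof (cases "V = {}")
    case False
    have IH: "signed_count (V - S) (order_maps col_order row_order (V - S)) =
        (if V - S \<subseteq> ?Z then 1 else 0)" if "S \<in> ?T" for S
    proof (rule less.hyps)
      show "card (V - S) < card V"
        using fin top_blockD(1,2)[OF that] by (intro psubset_card_mono) auto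
    qed (use fin down_closed_diff_top_block[OF down that] in auto)
    define A where "A = {S \<in> ?T. V - S \<subseteq> ?Z}"
    have fT: "finite ?T" by (rule finite_top_blocks[OF fin])
    have "signed_count V (order_maps col_order row_order V) =
        (\<Sum>S\<in>?T. if V - S \<subseteq> ?Z then (-1) ^ (card S + 1) else 0)"
      unfolding signed_count_order_maps[OF fin False] by (rule sum.cong) (simp_all add: IH)
    also have "\<dots> = (\<Sum>S\<in>A. (-1) ^ (card S + 1))"
      unfolding A_def by (rule sum.inter_filter[symmetric, OF fT])
    finally have N: "signed_count V (order_maps col_order row_order V) = - (\<Sum>S\<in>A. (-1) ^ card S)"
      by (simp add: sum_negf)
    obtain i j where "(i, j) \<in> V" using False by auto
    then have "(i, 0) \<in> V" using down unfolding down_closed_def by blast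
    have "{i. (i, 0) \<in> V} \<subseteq> fst ` V" by force
    then have finI: "finite {i. (i, 0) \<in> V}" by (rule finite_subset) (simp add: fin)
    define m where "m = Max {i. (i, 0) \<in> V}"
    have "m \<in> {i. (i, 0) \<in> V}" unfolding m_def
      by (rule Max_in[OF finI]) (use \<open>(i, 0) \<in> V\<close> in auto)
    then have bV: "(m, 0) \<in> V" by simp
    have le: "i \<le> m" if "(i, 0) \<in> V" for i unfolding m_def
      by (rule Max_ge[OF finI]) (use that in simp)
    have bP: "((m, 0), v) \<notin> col_order" if "v \<in> V" for v
      using that le[of "fst v"] by (auto simp: col_order_def)
    show ?thesis
    proof (cases "V \<subseteq> ?Z")
      case True
      have "S = {(m, 0)}" if S: "S \<in> ?T" for S
      proof -
        have "u = (m, 0)" if u: "u \<in> S" for u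
        proof -
          have uV: "u \<in> V" using u top_blockD(1)[OF S] by auto
          then obtain i where i: "u = (i, 0)" using True by auto
          have "(u, (m, 0)) \<notin> col_order" by (rule top_blockD(3)[OF S u bV])
          then have "\<not> i < m" by (simp add: i col_order_def)
          then show ?thesis using le[of i] uV i by simp
        qed
        then show ?thesis using top_blockD(2)[OF S] by auto
      qed
      moreover have "{(m, 0)} \<in> ?T"
        using bV bP True by (intro top_blockI) (auto simp: row_order_def)
      ultimately have "A = {{(m, 0)}}" using True unfolding A_def by blast
      then show ?thesis using True N by simp
    next
      case False
      then obtain c where c: "c \<in> V" "c \<notin> ?Z" by auto
      have "(\<Sum>S\<in>A. (-1) ^ card S :: rat) = 0"
      proof (rule sum_sign_toggle[where b = "(m, 0)"])
        show "finite A" using fT by (simp add: A_def)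
        show "finite S" if "S \<in> A" for S
          using that finite_subset[OF top_blockD(1) fin] unfolding A_def by blast
        show "insert (m, 0) S \<in> A" if "S \<in> A" for S
        proof -
          have S: "S \<in> ?T" and Z: "V - S \<subseteq> ?Z" using that by (auto simp: A_def)
          \<comment> \<open>Cells to the right of \<open>(m, 0)\<close> lie outside the first
            column, hence already in \<open>S\<close>.\<close>
          have "v \<in> S" if "v \<in> V" "((m, 0), v) \<in> row_order" for v
            using that Z by (auto simp: row_order_def)
          then have "insert (m, 0) S \<in> ?T"
            using bV bP top_blockD(1)[OF S] top_blockD(3,4)[OF S]
            by (intro top_blockI) blast+
          then show ?thesis using Z by (auto simp: A_def)
        qed
        show "S - {(m, 0)} \<in> A" if "S \<in> A" for S
        proof -
          have S: "S \<in> ?T" and Z: "V - S \<subseteq> ?Z" using that by (auto simp: A_def)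
          \<comment> \<open>The cell \<open>c\<close> outside the first column keeps the block
            nonempty; \<open>(m, 0)\<close> starts its row, so dropping it breaks no closure
            condition.\<close>
          have "c \<in> S - {(m, 0)}" using c Z by auto
          moreover have "(u, (m, 0)) \<notin> row_order" for u by (auto simp: row_order_def)
          ultimately have "S - {(m, 0)} \<in> ?T"
            using top_blockD(1)[OF S] top_blockD(3,4)[OF S]
            by (intro top_blockI) blast+
          then show ?thesis using Z by (auto simp: A_def)
        qed
      qed
      then show ?thesis using False N by simp
    qed
  qed (simp add: signed_count_empty)
qed

section \<open>The signed coefficient sum as a linear functional\<close>

text \<open>The monomials x_1^a_1 ... x_l^a_l with all exponents positive, that is, the compositions
  of \<open>n\<close>.\<close>

definition packed_msets :: "nat \<Rightarrow> nat multiset set" where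
  "packed_msets n = {M. size M = n \<and> set_mset M = {1..card (set_mset M)}}"

text \<open>Defined on all series; among Schur functions it will be 1 at the column of height
  \<open>n\<close> and 0 elsewhere.\<close>

definition sign_coeff :: "nat \<Rightarrow> series \<Rightarrow> rat" where
  "sign_coeff n F = (\<Sum>M\<in>packed_msets n. (-1) ^ (n + card (set_mset M)) * F M)"

lemma finite_packed_msets: "finite (packed_msets n)"
proof (rule finite_subset)
  show "packed_msets n \<subseteq> mset ` {xs. set xs \<subseteq> {1..n} \<and> length xs = n}"
  proof
    fix M assume M: "M \<in> packed_msets n"
    obtain xs where xs: "M = mset xs" by (metis ex_mset)
    have l: "length xs = n" and s: "set xs = {1..card (set xs)}"
      using M unfolding packed_msets_def xs mem_Collect_eq set_mset_mset size_mset by blast+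
    have "card (set xs) \<le> n" using card_length[of xs] l by simp
    then have "set xs \<subseteq> {1..n}" by (subst s) auto
    then show "M \<in> mset ` {xs. set xs \<subseteq> {1..n} \<and> length xs = n}" using xs l by blast
  qed
  show "finite (mset ` {xs. set xs \<subseteq> {1..n} \<and> length xs = n})"
    by (intro finite_imageI finite_lists_length_eq) simp
qed

lemma sign_coeff_add: "sign_coeff n (F + F') = sign_coeff n F + sign_coeff n F'"
  by (simp add: sign_coeff_def distrib_left sum.distrib)

lemma sign_coeff_scale: "sign_coeff n (scale_series c F) = c * sign_coeff n F"
  by (simp add: sign_coeff_def scale_series_def sum_distrib_left mult.left_commute)

lemma sign_coeff_zero: "sign_coeff n 0 = 0"
  by (simp add: sign_coeff_def)

text \<open>The monomial of a map has degree \<open>card V\<close> and the image as support, so it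
  is packed exactly when the map is; grouping packed maps by monomial gives the count.\<close>

lemma sign_coeff_generating_function:
  assumes fin: "finite V" and \<F>: "\<F> \<subseteq> extensional V"
  shows "sign_coeff n (\<lambda>M. of_nat (card {f \<in> \<F>. image_mset f (mset_set V) = M})) =
    (if card V = n then signed_count V \<F> else 0)"
proof -
  let ?m = "\<lambda>f. image_mset f (mset_set V)"
  have set: "set_mset (?m f) = f ` V" for f :: "'a \<Rightarrow> nat" using fin by simp
  show ?thesis
  proof (cases "card V = n")
    case False
    have "card {f \<in> \<F>. ?m f = M} = 0" if "M \<in> packed_msets n" for M
    proof -
      have "size M = n" using that unfolding packed_msets_def by blast
      then have "{f \<in> \<F>. ?m f = M} = {}" using False by auto
      then show ?thesis by (simp only: card.empty)
    qed
    then have "sign_coeff n (\<lambda>M. of_nat (card {f \<in> \<F>. ?m f = M})) = 0"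
      unfolding sign_coeff_def by (intro sum.neutral) simp
    then show ?thesis using False by simp
  next
    case True
    have packed: "?m f \<in> packed_msets n \<longleftrightarrow> f \<in> packed_maps V" if "f \<in> \<F>" for f
    proof -
      have "f \<in> extensional V" "size (?m f) = n" using that \<F> True by auto
      then show ?thesis unfolding packed_msets_def packed_maps_def mem_Collect_eq set by blast
    qed
    have "sign_coeff n (\<lambda>M. of_nat (card {f \<in> \<F>. ?m f = M})) =
      (\<Sum>M\<in>packed_msets n. \<Sum>f\<in>{f \<in> \<F> \<inter> packed_maps V. ?m f = M}. (-1) ^ (card V + card (f ` V)))"
      unfolding sign_coeff_def
    proof (rule sum.cong[OF refl])
      fix M assume M: "M \<in> packed_msets n"
      have eq: "{f \<in> \<F>. ?m f = M} = {f \<in> \<F> \<inter> packed_maps V. ?m f = M}" (is "_ = ?B")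
        using packed M by blast
      have "(\<Sum>f\<in>?B. (-1) ^ (card V + card (f ` V))) =
          (\<Sum>f\<in>?B. (-1) ^ (n + card (set_mset M)) :: rat)"
        by (rule sum.cong) (use True set in auto)
      then show "(-1) ^ (n + card (set_mset M)) * of_nat (card {f \<in> \<F>. ?m f = M}) =
          (\<Sum>f\<in>?B. (-1) ^ (card V + card (f ` V)) :: rat)"
        unfolding eq by (simp add: mult.commute)
    qed
    also have "\<dots> = signed_count V \<F>"
      unfolding signed_count_def
      by (rule sum.group) (use finite_packed_maps[OF fin] finite_packed_msets packed in auto)
    finally show ?thesis using True by simp
  qed
qed

section \<open>Schur functions and the column coefficient\<close>

lemma ssyt_eq_order_maps: "ssyt \<mu> = order_maps col_order row_order (cells \<mu>)"
  by (auto simp: ssyt_def order_maps_def col_order_def row_order_def)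

lemma finite_cells: "finite (cells \<mu>)"
proof -
  have "cells \<mu> = (SIGMA i:{..<length \<mu>}. {..<\<mu> ! i})" by (auto simp: cells_def)
  then show ?thesis by simp
qed

lemma down_closed_cells:
  assumes "is_partition \<mu>"
  shows "down_closed (cells \<mu>)"
proof -
  have "\<mu> ! i \<le> \<mu> ! i'" if "i' \<le> i" "i < length \<mu>" for i i'
    using assms that sorted_wrt_nth_less[of "(\<ge>)" \<mu> i' i]
    by (cases "i' = i") (auto simp: is_partition_def)
  then show ?thesis by (fastforce simp: down_closed_def cells_def)
qed

lemma cells_column: "cells (replicate n (Suc 0)) = {..<n} \<times> {0}"
  by (auto simp: cells_def)

lemma is_partition_column: "is_partition (replicate n (Suc 0))"
  by (auto simp: is_partition_def sorted_wrt_iff_nth_less)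

lemma partition_in_column:
  assumes "is_partition \<mu>" "cells \<mu> \<subseteq> UNIV \<times> {0}"
  shows "\<mu> = replicate (card (cells \<mu>)) (Suc 0)"
proof -
  have "\<mu> ! i = Suc 0" if "i < length \<mu>" for i
  proof (rule ccontr)
    assume "\<mu> ! i \<noteq> Suc 0"
    moreover have "\<mu> ! i \<noteq> 0" using assms(1) that unfolding is_partition_def by (metis nth_mem)
    ultimately have "(i, 1) \<in> cells \<mu>" using that by (simp add: cells_def)
    then show False using assms(2) by auto
  qed
  then have eq: "\<mu> = replicate (length \<mu>) (Suc 0)" by (simp add: list_eq_iff_nth_eq)
  have "card (cells \<mu>) = length \<mu>"
    by (subst eq) (simp add: cells_column card_cartesian_product)
  then show ?thesis using eq by simp
qed

lemma sign_coeff_schur: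
  assumes \<mu>: "is_partition \<mu>"
  shows "sign_coeff n (schur \<mu>) = (if \<mu> = replicate n 1 then 1 else 0)"
proof -
  have ext: "ssyt \<mu> \<subseteq> extensional (cells \<mu>)" by (auto simp: ssyt_def PiE_def)
  have "sign_coeff n (schur \<mu>) =
      (if card (cells \<mu>) = n then if cells \<mu> \<subseteq> UNIV \<times> {0} then 1 else 0 else 0)"
    unfolding schur_def sign_coeff_generating_function[OF finite_cells ext]
    by (simp add: ssyt_eq_order_maps signed_count_tableaux[OF finite_cells down_closed_cells[OF \<mu>]])
  also have "\<dots> = (if \<mu> = replicate n 1 then 1 else 0)"
    using partition_in_column[OF \<mu>]
    by (auto simp: cells_column card_cartesian_product)
  finally show ?thesis .
qed

lemma schur_in_basis: "is_partition \<mu> \<Longrightarrow> schur \<mu> \<in> schur_basis"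
  by (simp add: schur_basis_def)

text \<open>Both sides are linear on the span, so they need only be compared on the basis.\<close>

lemma schur_coeff_column:
  assumes ind: "series.independent schur_basis" and F: "F \<in> series.span schur_basis"
  shows "schur_coeff (replicate n 1) F = sign_coeff n F"
proof -
  let ?r = "\<lambda>F. series.representation schur_basis F (schur (replicate n 1))"
  have col: "is_partition (replicate n 1)" using is_partition_column by simp
  have base: "?r x = sign_coeff n x" if x: "x \<in> schur_basis" for x
  proof -
    obtain \<mu> where \<mu>: "x = schur \<mu>" "is_partition \<mu>" using x by (auto simp: schur_basis_def)
    have "?r x = (if schur (replicate n 1) = x then 1 else 0)"
      by (simp add: series.representation_basis[OF ind x])
    \<comment> \<open>If \<open>\<mu>\<close> is not the column, \<open>sign_coeff n\<close> is 0 at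
      \<open>x\<close> and 1 at the column, so the two series differ.\<close>
    also have "\<dots> = sign_coeff n x"
      using sign_coeff_schur[OF \<mu>(2), of n] sign_coeff_schur[OF col, of n] \<mu>(1)
      by (metis (full_types))
    finally show ?thesis .
  qed
  \<comment> \<open>Span membership is carried along because additivity of
    \<open>representation\<close> requires it.\<close>
  have "F \<in> series.span schur_basis \<and> ?r F = sign_coeff n F"
    using F
  proof (induction rule: series.span_induct_alt)
    case base
    show ?case
      unfolding series.representation_zero sign_coeff_zero using series.span_zero by blast
  next
    case (step c x y)
    have x: "scale_series c x \<in> series.span schur_basis"
      by (rule series.span_scale[OF series.span_base[OF step(1)]])
    have "?r (scale_series c x + y) = c * ?r x + ?r y"
      using step x
      by (simp add: series.representation_add[OF ind] series.representation_scale[OF ind]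
          series.span_base)
    then have "?r (scale_series c x + y) = sign_coeff n (scale_series c x + y)"
      using step x base[OF step(1)] unfolding sign_coeff_add sign_coeff_scale by argo
    then show ?case using step x series.span_add by blast
  qed
  then show ?thesis by (simp add: schur_coeff_def)
qed

section \<open>Nonnegativity for chromatic symmetric functions\<close>

lemma sign_coeff_chromatic_nonneg:
  assumes "graph G"
  shows "sign_coeff n (chromatic_sym G) \<ge> 0"
proof -
  interpret graph G by fact
  have E: "arcs_ends G \<subseteq> verts G \<times> verts G" by (auto simp: arcs_ends_def arc_to_ends_def)
  have S: "sym (arcs_ends G)" using sym_arcs by (simp add: symmetric_def)
  have proper: "proper_colorings G = {f \<in> verts G \<rightarrow>\<^sub>E {1..}. \<forall>(u, v)\<in>arcs_ends G. f u \<noteq> f v}"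
    by (auto simp: proper_colorings_def)
  have ext: "proper_colorings G \<subseteq> extensional (verts G)"
    by (auto simp: proper_colorings_def PiE_def)
  have "signed_count (verts G) (proper_colorings G) \<ge> 0"
    unfolding proper by (rule signed_count_proper_nonneg[OF finite_verts E S])
  then show ?thesis
    unfolding chromatic_sym_def sign_coeff_generating_function[OF finite_verts ext] by simp
qed

section \<open>The complete graph\<close>

text \<open>A strictly increasing column, read downwards, is the sorted list of its set of
  entries.\<close>

lemma card_ssyt_column:
  assumes A: "finite A" "A \<subseteq> {1..}" and n: "card A = n"
  shows "card {T \<in> ssyt (replicate n 1). T ` cells (replicate n 1) = A} = 1"
proof -
  define l where "l = sorted_list_of_set A"
  have l: "length l = n" "sorted_wrt (<) l" "set l = A" using A n by (simp_all add: l_def)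
  define T0 where "T0 = (\<lambda>(i, j). if i < n \<and> j = (0::nat) then l ! i else undefined)"
  let ?C = "{..<n} \<times> {0 :: nat}"
  have C: "cells (replicate n 1) = ?C" by (simp add: cells_column)
  have Ci: "?C = (\<lambda>i. (i, 0)) ` {..<n}" by auto
  have "T = T0" if T: "T \<in> ssyt (replicate n 1)" "T ` ?C = A" for T
  proof -
    let ?t = "map (\<lambda>i. T (i, 0)) [0..<n]"
    have "T (i, 0) < T (i', 0)" if "i < i'" "i' < n" for i i'
      using T(1) that unfolding ssyt_def C by simp
    then have t: "sorted_wrt (<) ?t" by (simp add: sorted_wrt_iff_nth_less)
    have "set ?t = A" using T(2) unfolding Ci image_image by (simp add: atLeast0LessThan)
    then have "?t = l"
      using t l(2,3) unfolding strict_sorted_iff by (intro sorted_distinct_set_unique) simp_all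
    then have "T (i, 0) = l ! i" if "i < n" for i using that by auto
    moreover have "T p = undefined" if "p \<notin> ?C" for p
      using T(1) that PiE_arb[of T ?C] unfolding ssyt_def C by blast
    ultimately show ?thesis by (auto simp: T0_def fun_eq_iff)
  qed
  moreover have im: "T0 ` ?C = A"
  proof -
    have "T0 ` ?C = (\<lambda>i. l ! i) ` {..<n}"
      unfolding Ci image_image by (rule image_cong) (simp_all add: T0_def)
    also have "\<dots> = set l" unfolding set_conv_nth l(1) by auto
    finally show ?thesis using l(3) by simp
  qed
  moreover have "T0 \<in> ssyt (replicate n 1)"
  proof -
    have "T0 p \<in> {1..}" if "p \<in> ?C" for p using im A(2) imageI[OF that, of T0] by blast
    then have "T0 \<in> ?C \<rightarrow>\<^sub>E {1..}" by (auto simp: T0_def PiE_def extensional_def)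
    moreover have "l ! i < l ! i'" if "i < i'" "i' < n" for i i'
      using sorted_wrt_nth_less[OF l(2)] that l(1) by simp
    ultimately show ?thesis unfolding ssyt_def C by (simp add: T0_def)
  qed
  ultimately have "{T \<in> ssyt (replicate n 1). T ` cells (replicate n 1) = A} = {T0}"
    unfolding C by blast
  then show ?thesis by simp
qed

text \<open>The equation \<open>M = mset_set (set_mset M)\<close> expresses that the monomial is
  squarefree.\<close>

lemma image_mset_eq_iff_inj:
  assumes "finite V" "inj_on f V"
  shows "image_mset f (mset_set V) = M \<longleftrightarrow> f ` V = set_mset M \<and> M = mset_set (set_mset M)"
  using assms by (auto simp: image_mset_mset_set)

text \<open>Proper colorings of \<open>K\<close> and column tableaux are both injective, so only
  squarefree monomials of degree \<open>n\<close> occur; each comes from n! bijections but from one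
  tableau.\<close>

lemma chromatic_sym_complete:
  assumes K: "complete_digraph n K"
  shows "chromatic_sym K = scale_series (fact n) (schur (replicate n 1))"
proof
  fix M :: "nat multiset"
  interpret graph K using K by (simp add: complete_digraph_def)
  let ?V = "verts K" and ?C = "cells (replicate n 1)" and ?A = "set_mset M"
  have cV: "card ?V = n" and ends: "arcs_ends K = {(u, v). (u, v) \<in> ?V \<times> ?V \<and> u \<noteq> v}"
    using K by (auto simp: complete_digraph_def)
  have cC: "card ?C = n" by (simp add: cells_column card_cartesian_product)
  have proper: "proper_colorings K = {\<kappa> \<in> ?V \<rightarrow>\<^sub>E {1..}. inj_on \<kappa> ?V}"
    by (auto simp: proper_colorings_def ends inj_on_def)
  have injT: "inj_on T ?C" if "T \<in> ssyt (replicate n 1)" for T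
  proof (rule inj_onI)
    fix p q assume pq: "p \<in> ?C" "q \<in> ?C" "T p = T q"
    then obtain i i' where i: "p = (i, 0)" "q = (i', 0)" by (auto simp: cells_column)
    have "T (k, 0) < T (k', 0)" if "(k, 0) \<in> ?C" "(k', 0) \<in> ?C" "k < k'" for k k'
      using \<open>T \<in> ssyt _\<close> that unfolding ssyt_def by blast
    then show "p = q" using pq i by (metis less_irrefl nat_neq_iff)
  qed
  show "chromatic_sym K M = scale_series (fact n) (schur (replicate n 1)) M"
  proof (cases "M = mset_set ?A \<and> card ?A = n \<and> ?A \<subseteq> {1..}")
    case True
    have "{\<kappa> \<in> proper_colorings K. image_mset \<kappa> (mset_set ?V) = M} =
        {\<kappa> \<in> ?V \<rightarrow>\<^sub>E ?A. inj_on \<kappa> ?V}" (is "?L = ?R")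
    proof (intro set_eqI iffI)
      fix \<kappa> assume "\<kappa> \<in> ?L"
      then show "\<kappa> \<in> ?R" by (auto simp: proper image_mset_eq_iff_inj PiE_def)
    next
      fix \<kappa> assume k: "\<kappa> \<in> ?R"
      \<comment> \<open>An injective map into a set of the same finite size is onto.\<close>
      then have "\<kappa> ` ?V = ?A"
        using True cV by (intro card_subset_eq) (auto simp: card_image)
      then show "\<kappa> \<in> ?L" using True k by (auto simp: proper image_mset_eq_iff_inj PiE_def)
    qed
    moreover have "card ?R = fact n"
    proof -
      have "card ?R = prod ((-) n) {0..<n}"
        using card_inj_on_subset_funcset[of ?V ?A ?V] True cV by simp
      also have "\<dots> = fact n" by (simp add: fact_prod_rev)
      finally show ?thesis .
    qed
    ultimately have "chromatic_sym K M = fact n" by (simp add: chromatic_sym_def)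
    moreover have "{T \<in> ssyt (replicate n 1). image_mset T (mset_set ?C) = M} =
        {T \<in> ssyt (replicate n 1). T ` ?C = ?A}"
      using image_mset_eq_iff_inj[OF finite_cells injT] True by blast
    then have "schur (replicate n 1) M = 1"
      using card_ssyt_column[of ?A n] True by (simp add: schur_def)
    ultimately show ?thesis by (simp add: scale_series_def)
  next
    case False
    \<comment> \<open>The monomial has a repeated index, the wrong degree or the index 0. The type
      of \<open>W\<close> is left open to serve both vertices and cells.\<close>
    have no: "False" if "finite W" "card W = n" "f \<in> W \<rightarrow>\<^sub>E {1..}" "inj_on f W"
      "image_mset f (mset_set W) = M" for W :: "'x set" and f
    proof -
      have "f ` W = ?A" "M = mset_set ?A" using that image_mset_eq_iff_inj by blast+
      moreover from this have "card ?A = n" using that by (metis card_image)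
      moreover have "f ` W \<subseteq> {1..}" using that(3) by auto
      ultimately show False using False by blast
    qed
    have "{\<kappa> \<in> proper_colorings K. image_mset \<kappa> (mset_set ?V) = M} = {}"
      using no[OF finite_verts cV] by (auto simp: proper)
    moreover have "{T \<in> ssyt (replicate n 1). image_mset T (mset_set ?C) = M} = {}"
    proof -
      have "T \<in> ?C \<rightarrow>\<^sub>E {1..}" if "T \<in> ssyt (replicate n 1)" for T
        using that unfolding ssyt_def by blast
      then show ?thesis using no[OF finite_cells cC] injT by blast
    qed
    ultimately show ?thesis
      unfolding chromatic_sym_def scale_series_def schur_def
      by (simp only: card.empty of_nat_0 mult_zero_right)
  qed
qed

section \<open>Comparison with the complete graph\<close>

theorem theorem2p22:
  fixes n :: nat
    and G :: "('a, 'b) pre_digraph"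
    and K :: "('c, 'd) pre_digraph"
  assumes "n \<ge> 1"
    and "graph G" and "connected G" and "card (verts G) = n"
    and "complete_digraph n K"
  shows "G \<ge>\<^sub>s K \<longleftrightarrow> schur_positive (chromatic_sym G)"
proof (cases "series.independent schur_basis")
  case False
  \<comment> \<open>This case does not occur, but refuting it is unnecessary: \<open>representation\<close> is then \<open>0\<close>.\<close>
  then have "schur_coeff \<mu> F = 0" for \<mu> F
    by (simp add: schur_coeff_def series.representation_def)
  then have "X_s G K = chromatic_sym G"
    by (simp add: X_s_def scale_series_def fun_eq_iff)
  then show ?thesis by (simp add: schur_ge_def)
next
  case True
  let ?X = "chromatic_sym G" and ?e = "schur (replicate n 1)"
  let ?r = "series.representation schur_basis"
  define c where "c = schur_coeff (replicate n 1) ?X"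
  have col: "is_partition (replicate n 1)" using is_partition_column by simp
  have e: "?e \<in> schur_basis" by (rule schur_in_basis[OF col])
  note e_span = series.span_base[OF e]
  have ce_span: "scale_series c ?e \<in> series.span schur_basis" by (rule series.span_scale[OF e_span])
  have "card (verts K) = n" using assms(5) by (simp add: complete_digraph_def)
  moreover have "schur_coeff (replicate n 1) (chromatic_sym K) = fact n"
    unfolding chromatic_sym_complete[OF assms(5)] schur_coeff_def
      series.representation_scale[OF True e_span] series.representation_basis[OF True e]
    by simp
  \<comment> \<open>The scalar is \<open>c\<close> divided by n!, which cancels the factor n! of the
    complete graph.\<close>
  ultimately have X: "X_s G K = ?X - scale_series c ?e"
    unfolding X_s_def chromatic_sym_complete[OF assms(5)]
    by (simp add: assms(4) c_def)
  have span: "X_s G K \<in> series.span schur_basis \<longleftrightarrow> ?X \<in> series.span schur_basis"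
  proof
    assume "X_s G K \<in> series.span schur_basis"
    from series.span_add[OF this ce_span] show "?X \<in> series.span schur_basis" by (simp add: X)
  qed (unfold X, rule series.span_diff[OF _ ce_span])
  \<comment> \<open>\<open>representation\<close> is indexed by basis vectors, so the indicator
    compares series rather than partitions.\<close>
  have coeff: "schur_coeff \<mu> (X_s G K) = schur_coeff \<mu> ?X - c * (if schur \<mu> = ?e then 1 else 0)"
    if sp: "?X \<in> series.span schur_basis" for \<mu>
    using fun_cong[OF series.representation_diff[OF True ce_span sp], of "schur \<mu>"]
    unfolding X schur_coeff_def series.representation_scale[OF True e_span]
      series.representation_basis[OF True e] .
  \<comment> \<open>Only the coefficient at \<open>?e\<close> changes, from \<open>c\<close> to 0,
    and both values are nonnegative.\<close>
  have "schur_coeff \<mu> (X_s G K) \<ge> 0 \<longleftrightarrow> schur_coeff \<mu> ?X \<ge> 0"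
    if sp: "?X \<in> series.span schur_basis" for \<mu>
  proof (cases "schur \<mu> = ?e")
    case eq: True
    then have c: "schur_coeff \<mu> ?X = c" by (simp add: c_def schur_coeff_def)
    have "c \<ge> 0"
      unfolding c_def schur_coeff_column[OF True sp] by (rule sign_coeff_chromatic_nonneg[OF assms(2)])
    then show ?thesis using coeff[OF sp, of \<mu>] c eq by simp
  qed (simp add: coeff[OF sp])
  then show ?thesis unfolding schur_ge_def schur_positive_def span by blast
qed

end
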